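(* Let $\mathcal{S}$ be a transitive temporal feedback graph on $T$ rounds with $K=2$ actions. Then every $\mathcal{S}$-learning algorithm $\mathcal{A}$ has worst-case regret $\mathrm{Reg}(\mathcal{A})\ge\mathsf{UB}(\mathcal{S})/50$.
   Context: Setting: $T$ rounds, actions $x_t\in\Delta_K$, losses $\ell_t\in[0,1]^K$. A temporal feedback graph $\mathcal{S}$ is a collection of subsets $S_t\subseteq[T]\setminus\{t\}$, viewed as a directed graph with edge $s\to t$ iff $s\in S_t$; it is transitive if this graph is acyclic and whenever $s\in S_t$ and $r\in S_s$ we have $r\in S_t$. An $\mathcal{S}$-learning algorithm chooses $x_t$ as a function of $(\ell_s)_{s\in S_t}$ only; its worst-case regret is $\mathrm{Reg}(\mathcal{A})=\max_{\boldsymbol\ell}\big(\sum_t\langle x_t,\ell_t\rangle-\min_{x^*\in\Delta_K}\sum_t\langle x^*,\ell_t\rangle\big)$. An order is a sequence $t_1,\dots,t_w$ with $t_u\in S_{t_v}$ for all $u<v$; maximal if no super-sequence is an order; $C_1,\dots,C_N$ are the maximal orders. $\mathsf{UB}(\mathcal{S})$ is the optimal value of: minimize $\sum_{c=1}^N\sqrt{\sum_{t\in C_c}\lambda_{c,t}^2}$ subject to $\sum_c\lambda_{c,t}=1$ for all $t$, $\lambda_{c,t}=0$ if $t\notin C_c$, $\lambda_{c,t}\ge0$. *)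

theory Defs
  imports Complex_Main "HOL-Library.Sublist"
begin

(* Rounds are 0..T-1, actions are 0..K-1.  Vectors in R^K are functions nat => real
   (only coordinates < K are relevant). *)

definition simplex :: "nat \<Rightarrow> (nat \<Rightarrow> real) set" where
  "simplex K = {x. (\<forall>i<K. 0 \<le> x i) \<and> (\<Sum>i<K. x i) = 1}"

definition loss_seqs :: "nat \<Rightarrow> nat \<Rightarrow> (nat \<Rightarrow> nat \<Rightarrow> real) set" where
  "loss_seqs T K = {l. \<forall>t<T. \<forall>i<K. 0 \<le> l t i \<and> l t i \<le> 1}"

definition temporal_feedback_graph :: "nat \<Rightarrow> (nat \<Rightarrow> nat set) \<Rightarrow> bool" where
  "temporal_feedback_graph T S \<longleftrightarrow> (\<forall>t<T. S t \<subseteq> {..<T} - {t})"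

definition fg_edges :: "nat \<Rightarrow> (nat \<Rightarrow> nat set) \<Rightarrow> (nat \<times> nat) set" where
  "fg_edges T S = {(s, t). t < T \<and> s \<in> S t}"

definition transitive_fg :: "nat \<Rightarrow> (nat \<Rightarrow> nat set) \<Rightarrow> bool" where
  "transitive_fg T S \<longleftrightarrow> acyclic (fg_edges T S) \<and>
     (\<forall>t<T. \<forall>s\<in>S t. \<forall>r\<in>S s. r \<in> S t)"

definition S_learning :: "nat \<Rightarrow> nat \<Rightarrow> (nat \<Rightarrow> nat set)
    \<Rightarrow> (nat \<Rightarrow> (nat \<Rightarrow> nat \<Rightarrow> real) \<Rightarrow> (nat \<Rightarrow> real)) \<Rightarrow> bool" where
  "S_learning T K S A \<longleftrightarrow>
     (\<forall>l\<in>loss_seqs T K. \<forall>t<T. A t l \<in> simplex K) \<and>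
     (\<forall>l\<in>loss_seqs T K. \<forall>l'\<in>loss_seqs T K. \<forall>t<T.
        (\<forall>s\<in>S t. \<forall>i<K. l s i = l' s i) \<longrightarrow> (\<forall>i<K. A t l i = A t l' i))"

definition regret_seq :: "nat \<Rightarrow> nat \<Rightarrow> (nat \<Rightarrow> (nat \<Rightarrow> nat \<Rightarrow> real) \<Rightarrow> (nat \<Rightarrow> real))
    \<Rightarrow> (nat \<Rightarrow> nat \<Rightarrow> real) \<Rightarrow> real" where
  "regret_seq T K A l =
     (\<Sum>t<T. \<Sum>i<K. A t l i * l t i)
     - (INF x\<in>simplex K. \<Sum>t<T. \<Sum>i<K. x i * l t i)"

definition Reg :: "nat \<Rightarrow> nat \<Rightarrow> (nat \<Rightarrow> (nat \<Rightarrow> nat \<Rightarrow> real) \<Rightarrow> (nat \<Rightarrow> real)) \<Rightarrow> real" where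
  "Reg T K A = (SUP l\<in>loss_seqs T K. regret_seq T K A l)"

definition is_order :: "nat \<Rightarrow> (nat \<Rightarrow> nat set) \<Rightarrow> nat list \<Rightarrow> bool" where
  "is_order T S ts \<longleftrightarrow> set ts \<subseteq> {..<T} \<and>
     (\<forall>u v. u < v \<and> v < length ts \<longrightarrow> ts ! u \<in> S (ts ! v))"

definition maximal_orders :: "nat \<Rightarrow> (nat \<Rightarrow> nat set) \<Rightarrow> nat list set" where
  "maximal_orders T S = {ts. is_order T S ts \<and>
     \<not> (\<exists>ys. is_order T S ys \<and> subseq ts ys \<and> ys \<noteq> ts)}"

definition UB :: "nat \<Rightarrow> (nat \<Rightarrow> nat set) \<Rightarrow> real" where
  "UB T S = Inf {(\<Sum>c\<in>maximal_orders T S. sqrt (\<Sum>t\<in>set c. (lam c t)\<^sup>2)) | lam.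
     (\<forall>t<T. (\<Sum>c\<in>maximal_orders T S. lam c t) = 1) \<and>
     (\<forall>c\<in>maximal_orders T S. \<forall>t. t \<notin> set c \<longrightarrow> lam c t = 0) \<and>
     (\<forall>c\<in>maximal_orders T S. \<forall>t. 0 \<le> lam c t)}"

end

theory Submission
  imports Defs "HOL-Analysis.Function_Topology"
begin

text \<open>
  By duality, \<open>UB\<close> is (up to an arbitrarily small error) a total weight \<open>\<Sum>t. \<mu> t\<close> such that
  \<open>\<Sum>t\<in>C. (\<mu> t)\<^sup>2 \<le> 1\<close> on every order \<open>C\<close>. By transitivity, each round \<open>t\<close> can then be given an
  interval of length \<open>(\<mu> t)\<^sup>2\<close> in \<open>[0, 1]\<close> that lies to the right of the intervals of all the rounds it
  observes. Cut \<open>[0, 1]\<close> into atoms \<open>j\<close> of length \<open>a j\<close> at the end points of the intervals, attach an independent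
  random sign \<open>\<epsilon> j\<close> to each atom, and let the difference of the two losses in round \<open>t\<close> be
  \<open>v t = Im (\<Prod>j. 1 + \<i> \<epsilon> j sqrt (a j) / \<mu> t) / 2\<close>, the product being over the atoms of \<open>t\<close>.
  It is bounded by \<open>1\<close>, and it is odd in the signs of the interval of \<open>t\<close>, about which the learner
  knows nothing in round \<open>t\<close>, so the learner gains nothing over the uniform action. On the other hand
  \<open>\<Phi> = Im (\<Prod>j. 1 + \<i> \<epsilon> j sqrt (a j)) / 2\<close>, the product being over all atoms, is bounded by \<open>1\<close> and
  has correlation at least \<open>\<mu> t / 4\<close> with each \<open>v t\<close>. Hence the expectation of \<open>\<bar>\<Sum>t. v t\<bar>\<close>, which is
  twice the advantage of the best fixed action, is at least \<open>(\<Sum>t. \<mu> t) / 4\<close>.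
\<close>

section \<open>Approximate duality for the fractional cover program\<close>

text \<open>Concavity, read off from a nonnegative square; it turns the exact change of a sum of
  squares into a linear bound on the change of its root.\<close>

lemma sqrt_add_le_tangent:
  fixes x d :: real
  assumes "0 < x" "0 \<le> x + d"
  shows "sqrt (x + d) \<le> sqrt x + d / (2 * sqrt x)"
proof -
  have "0 \<le> (sqrt (x + d) - sqrt x)\<^sup>2" by simp
  also have "\<dots> = 2 * x + d - 2 * sqrt (x + d) * sqrt x"
    using assms by (simp add: power2_diff)
  finally have "2 * sqrt x * sqrt (x + d) \<le> 2 * x + d" by (simp add: ac_simps)
  also have "\<dots> = 2 * sqrt x * (sqrt x + d / (2 * sqrt x))"
    using assms by (simp add: field_simps)
  finally show ?thesis using assms by simp
qed

text \<open>Entries lie in \<open>[0, 1]\<close>, being terms of a nonnegative column sum equal to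
  1, and all other coordinates are fixed at 0, so Tychonoff applies. Compactness provides the
  minimiser used for duality.\<close>

lemma compact_fractional_covers:
  fixes M :: "'c \<Rightarrow> 'a set"
  assumes "finite N" "finite I" "\<And>c. c \<in> N \<Longrightarrow> M c \<subseteq> I"
  shows "compact {p :: 'c \<times> 'a \<Rightarrow> real. (\<forall>q. 0 \<le> p q) \<and>
    (\<forall>c t. c \<notin> N \<or> t \<notin> M c \<longrightarrow> p (c, t) = 0) \<and> (\<forall>t\<in>I. (\<Sum>c\<in>N. p (c, t)) = 1)}"
    (is "compact ?K")
proof -
  define B :: "'c \<times> 'a \<Rightarrow> real set"
    where "B = (\<lambda>(c, t). if c \<in> N \<and> t \<in> M c then {0..1} else {0})"
  let ?H = "\<Inter>t\<in>I. {p :: 'c \<times> 'a \<Rightarrow> real. (\<Sum>c\<in>N. p (c, t)) = 1}"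
  have "p (c, t) \<le> 1" if "p \<in> ?K" "c \<in> N" "t \<in> M c" for p c t
  proof -
    have "p (c, t) \<le> (\<Sum>c\<in>N. p (c, t))"
      using that assms(1) by (intro member_le_sum) auto
    then show ?thesis using that assms(3) by fastforce
  qed
  then have "?K = PiE UNIV B \<inter> ?H"
    by (auto simp: B_def PiE_iff split: if_splits) (metis order_refl)+
  moreover have "compact (PiE UNIV B)"
  proof -
    have "compactin (product_topology (\<lambda>_. euclidean) UNIV) (PiE UNIV B)"
      by (subst compactin_PiE) (auto simp: B_def)
    then show ?thesis by (simp add: euclidean_product_topology)
  qed
  moreover have "closed ?H"
    by (intro closed_INT ballI closed_Collect_eq continuous_on_sum continuous_on_const
        continuous_on_product_coordinates)
  ultimately show ?thesis by (simp add: compact_Int_closed)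
qed

text \<open>Smoothing the square roots by \<open>e\<close> makes the objective differentiable also where a
  \<open>\<lambda>\<^sub>c\<close> vanishes. At a minimiser, moving mass within column \<open>t\<close> shows that the partial
  derivatives in that column are smallest on the support; this common value is the dual
  variable \<open>\<mu>\<^sub>t\<close>, so no general multiplier theorem is needed.\<close>

lemma fractional_cover_approx_duality:
  fixes M :: "'c \<Rightarrow> 'a set" and e :: real
  assumes N: "finite N" and I: "finite I" and MI: "\<And>c. c \<in> N \<Longrightarrow> M c \<subseteq> I"
    and cover: "\<And>t. t \<in> I \<Longrightarrow> \<exists>c\<in>N. t \<in> M c" and e: "0 < e"
  obtains lam :: "'c \<Rightarrow> 'a \<Rightarrow> real" and mu :: "'a \<Rightarrow> real"
  where "\<forall>t\<in>I. (\<Sum>c\<in>N. lam c t) = 1" "\<forall>c\<in>N. \<forall>t. t \<notin> M c \<longrightarrow> lam c t = 0"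
    "\<forall>c\<in>N. \<forall>t. 0 \<le> lam c t" "\<And>t. t \<in> I \<Longrightarrow> 0 \<le> mu t"
    "\<And>c. c \<in> N \<Longrightarrow> (\<Sum>t\<in>M c. (mu t)\<^sup>2) \<le> 1"
    "(\<Sum>c\<in>N. sqrt (\<Sum>t\<in>M c. (lam c t)\<^sup>2)) \<le> (\<Sum>t\<in>I. mu t) + card N * e"
proof -
  define K where "K = {p :: 'c \<times> 'a \<Rightarrow> real. (\<forall>q. 0 \<le> p q) \<and>
    (\<forall>c t. c \<notin> N \<or> t \<notin> M c \<longrightarrow> p (c, t) = 0) \<and> (\<forall>t\<in>I. (\<Sum>c\<in>N. p (c, t)) = 1)}"
  define Q where "Q = (\<lambda>c (p :: 'c \<times> 'a \<Rightarrow> real). e\<^sup>2 + (\<Sum>t\<in>M c. (p (c, t))\<^sup>2))"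
  define F where "F = (\<lambda>p. \<Sum>c\<in>N. sqrt (Q c p))"
  have finM: "finite (M c)" if "c \<in> N" for c
    using MI[OF that] I finite_subset by blast
  have Qpos: "0 < Q c p" for c p
    unfolding Q_def using e by (intro add_pos_nonneg sum_nonneg) auto
  have "K \<noteq> {}"
  proof -
    obtain k where k: "\<And>t. t \<in> I \<Longrightarrow> k t \<in> N \<and> t \<in> M (k t)" using cover by metis
    have "(\<lambda>(c, t). if t \<in> I \<and> c = k t then 1 else 0) \<in> K"
      unfolding K_def using k N MI by auto
    then show ?thesis by blast
  qed
  moreover have "continuous_on K F"
    unfolding F_def Q_def
    by (intro continuous_intros continuous_on_subset[OF continuous_on_product_coordinates]) auto
  moreover have "compact K"
    unfolding K_def using N I MI by (rule compact_fractional_covers)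
  ultimately obtain p where pK: "p \<in> K" and pmin: "\<And>p'. p' \<in> K \<Longrightarrow> F p \<le> F p'"
    using continuous_attains_inf by metis
  have p0: "0 \<le> p q" for q using pK by (cases q) (simp add: K_def)
  have pz: "p (c, t) = 0" if "c \<notin> N \<or> t \<notin> M c" for c t using pK that by (auto simp: K_def)
  have p1: "(\<Sum>c\<in>N. p (c, t)) = 1" if "t \<in> I" for t using pK that by (auto simp: K_def)
  \<comment> \<open>The partial derivatives of \<open>F\<close> at the minimiser
    \<open>p\<close>.\<close>
  define g where "g = (\<lambda>c t. p (c, t) / sqrt (Q c p))"
  have g0: "0 \<le> g c t" for c t unfolding g_def using p0 Qpos[of c p] by simp
  have key: "g c t \<le> g c' t"
    if c: "c \<in> N" "t \<in> M c" and c': "c' \<in> N" "t \<in> M c'" and pos: "0 < p (c, t)" for c c' t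
  proof (cases "c = c'")
    case False
    define u where "u = sqrt (Q c p)"
    define u' where "u' = sqrt (Q c' p)"
    have u: "0 < u" "0 < u'" using Qpos by (auto simp: u_def u'_def)
    \<comment> \<open>Moving mass \<open>d\<close> from \<open>c\<close> to \<open>c'\<close>
      changes \<open>F\<close> by at most \<open>- d\<close> times the slope gap plus a term of
      order \<open>d\<^sup>2\<close>; minimality bounds the gap by a multiple of
      \<open>d\<close>.\<close>
    have small: "g c t - g c' t \<le> d * (1 / (2 * u) + 1 / (2 * u'))" if d: "0 < d" "d \<le> p (c, t)" for d
    proof -
      define p' where "p' = p((c, t) := p (c, t) - d, (c', t) := p (c', t) + d)"
      have upd: "p' (a, s) = (if s = t then if a = c then p (c, t) - d
          else if a = c' then p (c', t) + d else p (a, t) else p (a, s))" for a s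
        using False by (auto simp: p'_def)
      have sum1: "(\<Sum>a\<in>N. p' (a, s)) = 1" if "s \<in> I" for s
      proof (cases "s = t")
        case True
        have "(\<Sum>a\<in>N. p' (a, s)) = (\<Sum>a\<in>N. p (a, t) + (if a = c then - d else 0)
            + (if a = c' then d else 0))"
          using True False by (intro sum.cong) (auto simp: upd)
        also have "\<dots> = 1"
          using N c c' p1 that True by (simp add: sum.distrib)
        finally show ?thesis .
      next
        case False
        then show ?thesis using p1[OF that] by (simp add: upd)
      qed
      have "p' \<in> K"
        unfolding K_def using p0 pz c c' d sum1 by (auto simp: upd)
      then have le: "F p \<le> F p'" by (rule pmin)
      have sumM: "(\<Sum>s\<in>M a. (p' (a, s))\<^sup>2) =
          (\<Sum>s\<in>M a. (p (a, s))\<^sup>2) + (p' (a, t))\<^sup>2 - (p (a, t))\<^sup>2" if "a \<in> N" "t \<in> M a" for a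
        using finM[OF that(1)] that by (simp add: sum.remove[of _ t] upd)
      have Qc: "Q c p' = Q c p + (d\<^sup>2 - 2 * p (c, t) * d)"
        using sumM[OF c] by (simp add: Q_def upd power2_eq_square algebra_simps)
      have Qc': "Q c' p' = Q c' p + (d\<^sup>2 + 2 * p (c', t) * d)"
        using sumM[OF c'] False by (simp add: Q_def upd power2_eq_square algebra_simps)
      have split: "F r = (\<Sum>a\<in>N - {c} - {c'}. sqrt (Q a r)) + sqrt (Q c r) + sqrt (Q c' r)" for r
        unfolding F_def using N c c' False by (simp add: sum.remove[of _ c] sum.remove[of _ c'])
      have "(\<Sum>a\<in>N - {c} - {c'}. sqrt (Q a p')) = (\<Sum>a\<in>N - {c} - {c'}. sqrt (Q a p))"
        by (intro sum.cong refl) (auto simp: Q_def p'_def)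
      with le have "u + u' \<le> sqrt (Q c p') + sqrt (Q c' p')"
        by (simp add: split u_def u'_def)
      also have "sqrt (Q c p') \<le> u + (d\<^sup>2 - 2 * p (c, t) * d) / (2 * u)"
        unfolding u_def Qc using Qpos[of c p] Qpos[of c p'] Qc
        by (intro sqrt_add_le_tangent) auto
      also have "sqrt (Q c' p') \<le> u' + (d\<^sup>2 + 2 * p (c', t) * d) / (2 * u')"
        unfolding u'_def Qc' using Qpos[of c' p] Qpos[of c' p'] Qc'
        by (intro sqrt_add_le_tangent) auto
      finally have "0 \<le> (d\<^sup>2 - 2 * p (c, t) * d) / (2 * u) + (d\<^sup>2 + 2 * p (c', t) * d) / (2 * u')"
        by simp
      also have "\<dots> = d * (d * (1 / (2 * u) + 1 / (2 * u')) - (g c t - g c' t))"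
        using u by (simp add: g_def u_def[symmetric] u'_def[symmetric] field_simps power2_eq_square)
      finally show ?thesis using d by (simp add: zero_le_mult_iff)
    qed
    have "g c t - g c' t \<le> 0"
    proof (rule ccontr)
      define w where "w = 1 / (2 * u) + 1 / (2 * u')"
      define y where "y = g c t - g c' t"
      assume "\<not> g c t - g c' t \<le> 0"
      then have y: "0 < y" by (simp add: y_def)
      have w: "0 < w" using u by (simp add: w_def add_pos_pos)
      \<comment> \<open>Small enough for \<open>d * w \<le> y / 2\<close>, yet no more than the mass
        available at \<open>(c, t)\<close>.\<close>
      define d where "d = min (p (c, t)) (y / (2 * w))"
      have "y \<le> d * w" using small[of d] pos y w by (simp add: d_def y_def w_def)
      also have "\<dots> \<le> y / (2 * w) * w" using w by (intro mult_right_mono) (auto simp: d_def)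
      also have "\<dots> < y" using w y by simp
      finally show False by simp
    qed
    then show ?thesis by simp
  qed simp
  define R where "R = (\<lambda>t. {c \<in> N. t \<in> M c})"
  define mu where "mu = (\<lambda>t. Min ((\<lambda>c. g c t) ` R t))"
  have R: "finite (R t)" "t \<in> I \<Longrightarrow> R t \<noteq> {}" for t
    using N cover by (auto simp: R_def)
  have mule: "mu t \<le> g c t" if "c \<in> N" "t \<in> M c" for c t
    unfolding mu_def using R(1) that by (intro Min_le) (auto simp: R_def)
  have mu0: "0 \<le> mu t" if "t \<in> I" for t
    unfolding mu_def using R that g0 by (subst Min_ge_iff) auto
  \<comment> \<open>Complementary slackness; off the support of \<open>p\<close> both sides are
    0.\<close>
  have mueq: "p (c, t) * mu t = p (c, t) * g c t" if "c \<in> N" "t \<in> I" for c t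
  proof (cases "0 < p (c, t)")
    case True
    then have "t \<in> M c" using pz by fastforce
    then have "g c t \<le> mu t"
      unfolding mu_def using R that key[OF that(1)] True by (subst Min_ge_iff) (auto simp: R_def)
    with mule[OF that(1) \<open>t \<in> M c\<close>] show ?thesis by simp
  next
    case False
    then show ?thesis using p0[of "(c, t)"] by simp
  qed
  \<comment> \<open>Row \<open>c\<close> of \<open>g\<close> is row \<open>c\<close> of
    \<open>p\<close> divided by slightly more than its norm, and \<open>mu\<close> lies below every
    row.\<close>
  have chain: "(\<Sum>t\<in>M c. (mu t)\<^sup>2) \<le> 1" if c: "c \<in> N" for c
  proof -
    have "(\<Sum>t\<in>M c. (mu t)\<^sup>2) \<le> (\<Sum>t\<in>M c. (g c t)\<^sup>2)"
      using mule[OF c] mu0 MI[OF c] by (intro sum_mono power_mono) auto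
    also have "\<dots> = (\<Sum>t\<in>M c. (p (c, t))\<^sup>2) / Q c p"
      using Qpos[of c p] by (simp add: g_def power_divide sum_divide_distrib)
    also have "\<dots> \<le> 1" using Qpos[of c p] by (simp add: Q_def)
    finally show ?thesis .
  qed
  have "(\<Sum>t\<in>I. mu t) = (\<Sum>t\<in>I. \<Sum>c\<in>N. p (c, t) * mu t)"
    using p1 by (simp add: sum_distrib_right[symmetric])
  also have "\<dots> = (\<Sum>t\<in>I. \<Sum>c\<in>N. p (c, t) * g c t)"
    using mueq by (intro sum.cong refl) auto
  also have "\<dots> = (\<Sum>c\<in>N. \<Sum>t\<in>I. p (c, t) * g c t)" by (rule sum.swap)
  also have "\<dots> = (\<Sum>c\<in>N. \<Sum>t\<in>M c. p (c, t) * g c t)"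
    using I MI pz by (intro sum.cong refl sum.mono_neutral_right) auto
  also have "\<dots> = (\<Sum>c\<in>N. (\<Sum>t\<in>M c. (p (c, t))\<^sup>2) / sqrt (Q c p))"
    by (simp add: g_def sum_divide_distrib power2_eq_square)
  finally have mu_sum: "(\<Sum>t\<in>I. mu t) = \<dots>" .
  \<comment> \<open>Smoothing costs at most \<open>e\<close> per row: if \<open>n\<close> is the
    norm of the row and \<open>q = sqrt (Q c p)\<close>, then
    \<open>n * q \<le> n * (e + n) \<le> n\<^sup>2 + e * q\<close>.\<close>
  have "sqrt (\<Sum>t\<in>M c. (p (c, t))\<^sup>2) \<le> (\<Sum>t\<in>M c. (p (c, t))\<^sup>2) / sqrt (Q c p) + e" for c
  proof -
    define n where "n = sqrt (\<Sum>t\<in>M c. (p (c, t))\<^sup>2)"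
    have n: "0 \<le> n" "n\<^sup>2 = (\<Sum>t\<in>M c. (p (c, t))\<^sup>2)"
      unfolding n_def by (auto simp: sum_nonneg)
    have Qn: "Q c p = e\<^sup>2 + n\<^sup>2" by (simp add: Q_def n)
    have q: "0 < sqrt (Q c p)" using Qpos by simp
    have "sqrt (Q c p) \<le> e + n"
      unfolding Qn using e n(1) by (intro real_le_lsqrt) (auto simp: power2_sum)
    then have "n * sqrt (Q c p) \<le> n * (e + n)" using n(1) by (rule mult_left_mono)
    moreover have "n \<le> sqrt (Q c p)"
      unfolding Qn by (intro real_le_rsqrt) simp
    then have "e * n \<le> e * sqrt (Q c p)" using e by simp
    ultimately have "n * sqrt (Q c p) \<le> n\<^sup>2 + e * sqrt (Q c p)"
      by (simp add: algebra_simps power2_eq_square)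
    then have "n \<le> n\<^sup>2 / sqrt (Q c p) + e"
      using q by (simp add: field_simps)
    then show ?thesis unfolding n(2) by (simp only: n_def)
  qed
  then have "(\<Sum>c\<in>N. sqrt (\<Sum>t\<in>M c. (p (c, t))\<^sup>2)) \<le> (\<Sum>t\<in>I. mu t) + card N * e"
    unfolding mu_sum by (subst sum_constant[symmetric], subst sum.distrib[symmetric]) (rule sum_mono)
  then show ?thesis
    using that[of "\<lambda>c t. p (c, t)" mu] p1 pz p0 mu0 chain by simp
qed

section \<open>Riesz products in independent random signs\<close>

text \<open>The set \<open>E\<close> encodes a choice of signs: \<open>\<epsilon> j = 1\<close> iff \<open>j \<in> E\<close>.\<close>

definition riesz :: "'j set \<Rightarrow> ('j \<Rightarrow> real) \<Rightarrow> 'j set \<Rightarrow> complex" where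
  "riesz P x E = (\<Prod>j\<in>P. Complex 1 (if j \<in> E then x j else - x j))"

text \<open>Independence of the signs: up to the factor \<open>2 ^ card P\<close>, the mean of the
  product is the product of the means.\<close>

lemma sum_Pow_prod_if:
  fixes f g :: "'j \<Rightarrow> 'b::comm_semiring_1"
  assumes "finite P"
  shows "(\<Sum>E\<in>Pow P. \<Prod>j\<in>P. if j \<in> E then f j else g j) = (\<Prod>j\<in>P. f j + g j)"
  unfolding prod_add[OF assms]
proof (rule sum.cong[OF refl])
  fix E assume "E \<in> Pow P"
  then have "P \<inter> {j. j \<in> E} = E" "P \<inter> - {j. j \<in> E} = P - E" by auto
  then show "(\<Prod>j\<in>P. if j \<in> E then f j else g j) = prod f E * prod g (P - E)"
    using prod.If_cases[OF assms, of "\<lambda>j. j \<in> E" f g] by simp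
qed

text \<open>Each factor has squared modulus \<open>1 + (x j)\<^sup>2\<close> whatever its sign, so
  the whole product has squared modulus at most \<open>exp 1 < 4\<close>.\<close>

lemma abs_Im_riesz_le:
  assumes "finite P" "(\<Sum>j\<in>P. (x j)\<^sup>2) \<le> 1"
  shows "\<bar>Im (riesz P x E)\<bar> \<le> 2"
proof -
  have "(cmod (riesz P x E))\<^sup>2 = (\<Prod>j\<in>P. 1 + (x j)\<^sup>2)"
    unfolding riesz_def prod_norm[symmetric] prod_power_distrib
    by (intro prod.cong refl) (auto simp: cmod_power2)
  also have "\<dots> \<le> (\<Prod>j\<in>P. exp ((x j)\<^sup>2))"
    by (intro prod_mono) (auto simp: add_nonneg_nonneg)
  also have "\<dots> = exp (\<Sum>j\<in>P. (x j)\<^sup>2)" using assms(1) by (simp add: exp_sum)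
  also have "\<dots> \<le> exp 1" using assms(2) by simp
  also have "\<dots> \<le> 2\<^sup>2" using exp_le by simp
  finally have "cmod (riesz P x E) \<le> 2" by (rule power2_le_imp_le) simp
  then show ?thesis using abs_Im_le_cmod order_trans by blast
qed

text \<open>Half the difference is the odd part of the expanded product and half the sum its even
  part; each dominates its lowest-degree term. A new factor mixes the two parts, so the induction
  carries both bounds.\<close>

lemma prod_one_plus_minus_diff_ge:
  fixes z :: "'j \<Rightarrow> real"
  assumes "finite P" "\<And>j. j \<in> P \<Longrightarrow> 0 \<le> z j"
  shows "2 * (\<Sum>j\<in>P. z j) \<le> (\<Prod>j\<in>P. 1 + z j) - (\<Prod>j\<in>P. 1 - z j) \<and>
    2 \<le> (\<Prod>j\<in>P. 1 + z j) + (\<Prod>j\<in>P. 1 - z j)"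
  using assms
proof (induction P rule: finite_induct)
  case (insert k P)
  define p where "p = (\<Prod>j\<in>P. 1 + z j)"
  define m where "m = (\<Prod>j\<in>P. 1 - z j)"
  have z: "0 \<le> z k" "0 \<le> (\<Sum>j\<in>P. z j)" using insert.prems by (auto intro: sum_nonneg)
  have IH: "2 * (\<Sum>j\<in>P. z j) \<le> p - m" "2 \<le> p + m"
    using insert.IH insert.prems by (auto simp: p_def m_def)
  have "z k * 2 \<le> z k * (p + m)" "0 \<le> z k * (p - m)"
    using z IH by (auto intro: mult_left_mono mult_nonneg_nonneg)
  then show ?case
    using insert.hyps IH by (simp add: p_def[symmetric] m_def[symmetric] algebra_simps)
qed simp

text \<open>Both terms of \<open>2 * (Im a * Im b) = Re (a * cnj b) - Re (a * b)\<close> factor over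
  the atoms, with sign averages \<open>1 + x j * y j\<close> and
  \<open>1 - x j * y j\<close>.\<close>

lemma sum_Im_riesz_mult_ge:
  assumes P: "finite P" and xy: "\<And>j. j \<in> P \<Longrightarrow> 0 \<le> x j * y j"
  shows "2 ^ card P * (\<Sum>j\<in>P. x j * y j) \<le> (\<Sum>E\<in>Pow P. Im (riesz P x E) * Im (riesz P y E))"
proof -
  have sq: "(\<Sum>E\<in>Pow P. riesz P x E * riesz P y' E) =
      2 ^ card P * of_real (\<Prod>j\<in>P. 1 - x j * y' j)" for y'
  proof -
    have "(\<Sum>E\<in>Pow P. riesz P x E * riesz P y' E) = (\<Sum>E\<in>Pow P. \<Prod>j\<in>P. if j \<in> E
        then Complex 1 (x j) * Complex 1 (y' j) else Complex 1 (- x j) * Complex 1 (- y' j))"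
      unfolding riesz_def prod.distrib[symmetric] by (intro sum.cong prod.cong refl) auto
    also have "\<dots> = (\<Prod>j\<in>P. 2 * of_real (1 - x j * y' j))"
      unfolding sum_Pow_prod_if[OF P] by (intro prod.cong refl) (simp add: complex_eq_iff)
    also have "\<dots> = 2 ^ card P * of_real (\<Prod>j\<in>P. 1 - x j * y' j)"
      unfolding prod.distrib by (simp only: prod_constant of_real_prod)
    finally show ?thesis .
  qed
  have cnj: "riesz P (\<lambda>j. - y j) E = cnj (riesz P y E)" for E
    unfolding riesz_def cnj_prod by (intro prod.cong refl) (auto simp: complex_eq_iff)
  have "2 * (Im a * Im b) = Re (a * cnj b) - Re (a * b)" for a b by simp
  then have "2 * (\<Sum>E\<in>Pow P. Im (riesz P x E) * Im (riesz P y E)) =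
      Re (\<Sum>E\<in>Pow P. riesz P x E * riesz P (\<lambda>j. - y j) E) - Re (\<Sum>E\<in>Pow P. riesz P x E * riesz P y E)"
    unfolding sum_distrib_left cnj Re_sum sum_subtractf[symmetric] by simp
  also have "\<dots> = 2 ^ card P * ((\<Prod>j\<in>P. 1 + x j * y j) - (\<Prod>j\<in>P. 1 - x j * y j))"
  proof -
    have re: "Re (2 ^ n * complex_of_real r) = 2 ^ n * r" for n r
      by (metis Re_complex_of_real of_real_mult of_real_numeral of_real_power)
    show ?thesis unfolding sq re by (simp add: right_diff_distrib)
  qed
  also have "\<dots> \<ge> 2 ^ card P * (2 * (\<Sum>j\<in>P. x j * y j))"
    using prod_one_plus_minus_diff_ge[of P, OF P xy] by (intro mult_left_mono) auto
  finally show ?thesis by simp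
qed

lemma riesz_cong:
  assumes "\<And>j. j \<in> P \<Longrightarrow> x j \<noteq> 0 \<Longrightarrow> j \<in> E \<longleftrightarrow> j \<in> E'"
  shows "riesz P x E = riesz P x E'"
  unfolding riesz_def using assms by (intro prod.cong refl) auto

text \<open>Reversing the signs at all nonzero coefficients conjugates every factor; a flip at a
  zero coefficient changes nothing.\<close>

lemma Im_riesz_flip:
  assumes "\<And>j. j \<in> P \<Longrightarrow> x j \<noteq> 0 \<Longrightarrow> j \<in> J"
  shows "Im (riesz P x (sym_diff E J)) = - Im (riesz P x E)"
proof -
  have "riesz P x (sym_diff E J) = cnj (riesz P x E)"
    unfolding riesz_def cnj_prod using assms
    by (intro prod.cong refl) (auto simp: complex_eq_iff)
  then show ?thesis by simp
qed

text \<open>Flipping \<open>J\<close> pairs terms that cancel. In the application \<open>G\<close>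
  is the bias of a learner who sees nothing of the block \<open>J\<close>.\<close>

lemma sum_Pow_flip_odd_eq_0:
  fixes G v :: "'j set \<Rightarrow> real"
  assumes "finite P" "J \<subseteq> P"
    and "\<And>E. E \<subseteq> P \<Longrightarrow> G (sym_diff E J) = G E" "\<And>E. E \<subseteq> P \<Longrightarrow> v (sym_diff E J) = - v E"
  shows "(\<Sum>E\<in>Pow P. G E * v E) = 0"
proof -
  have flip: "sym_diff (sym_diff E J) J = E" for E by auto
  have "(\<Sum>E\<in>Pow P. G E * v E) = (\<Sum>E\<in>Pow P. G (sym_diff E J) * v (sym_diff E J))"
    by (rule sum.reindex_bij_witness[of _ "\<lambda>E. sym_diff E J" "\<lambda>E. sym_diff E J"])
      (use assms(2) in \<open>auto simp: flip\<close>)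
  also have "\<dots> = (\<Sum>E\<in>Pow P. - (G E * v E))"
    using assms(3,4) by (intro sum.cong refl) auto
  finally show ?thesis by (simp add: sum_negf)
qed

section \<open>Regret with two actions\<close>

lemma two_actions_simplex_iff: "x \<in> simplex 2 \<longleftrightarrow> 0 \<le> x 0 \<and> 0 \<le> x 1 \<and> x 0 + x 1 = 1"
  by (auto simp: simplex_def numeral_2_eq_2 less_Suc_eq)

lemma sum_lessThan_two: "(\<Sum>i<2::nat. f i) = f 0 + (f 1 :: real)"
  by (simp add: numeral_2_eq_2)

lemma simplex_sum_mult_bounds:
  assumes "x \<in> simplex K" "\<And>i. i < K \<Longrightarrow> 0 \<le> y i \<and> y i \<le> 1"
  shows "0 \<le> (\<Sum>i<K. x i * y i)" "(\<Sum>i<K. x i * y i) \<le> 1"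
proof -
  show "0 \<le> (\<Sum>i<K. x i * y i)"
    using assms by (intro sum_nonneg) (auto simp: simplex_def)
  have "(\<Sum>i<K. x i * y i) \<le> (\<Sum>i<K. x i)"
    using assms by (intro sum_mono mult_left_le) (auto simp: simplex_def)
  then show "(\<Sum>i<K. x i * y i) \<le> 1" using assms(1) by (simp add: simplex_def)
qed

lemma bdd_below_comparator_loss:
  assumes "l \<in> loss_seqs T K"
  shows "bdd_below ((\<lambda>x. \<Sum>t<T. \<Sum>i<K. x i * l t i) ` simplex K)"
  using assms
  by (intro bdd_belowI2[of _ 0] sum_nonneg simplex_sum_mult_bounds(1)) (auto simp: loss_seqs_def)

lemma simplex_nonempty:
  assumes "0 < K"
  shows "simplex K \<noteq> {}"
proof -
  have "(\<lambda>i. if i = 0 then 1 else 0) \<in> simplex K"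
    using assms by (simp add: simplex_def)
  then show ?thesis by blast
qed

text \<open>A real supremum is an upper bound only of a bounded range; here the learner loses at
  most 1 per round and the comparator's infimum is nonnegative.\<close>

lemma regret_seq_le_Reg:
  assumes K: "0 < K" and l: "l \<in> loss_seqs T K" and A: "S_learning T K S A"
  shows "regret_seq T K A l \<le> Reg T K A"
  unfolding Reg_def
proof (rule cSUP_upper[OF l])
  show "bdd_above (regret_seq T K A ` loss_seqs T K)"
  proof (rule bdd_aboveI2[of _ _ "real T"])
    fix l assume l: "l \<in> loss_seqs T K"
    have s: "\<And>t. t < T \<Longrightarrow> A t l \<in> simplex K" using A l by (auto simp: S_learning_def)
    have "(\<Sum>t<T. \<Sum>i<K. A t l i * l t i) \<le> (\<Sum>t<T. 1)"
      using s l by (intro sum_mono simplex_sum_mult_bounds(2)) (auto simp: loss_seqs_def)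
    moreover have "0 \<le> (INF x\<in>simplex K. \<Sum>t<T. \<Sum>i<K. x i * l t i)"
      using simplex_nonempty[OF K] l
      by (intro cINF_greatest sum_nonneg simplex_sum_mult_bounds(1)) (auto simp: loss_seqs_def)
    ultimately show "regret_seq T K A l \<le> real T"
      by (simp add: regret_seq_def)
  qed
qed

text \<open>Uniform play would lose \<open>T / 2\<close>. The learner departs from this by half the
  correlation of its bias with \<open>v\<close>, the better pure action by half of
  \<open>\<bar>\<Sum>t<T. v t\<bar>\<close>.\<close>

lemma two_action_regret_ge:
  assumes v: "\<And>t. t < T \<Longrightarrow> \<bar>v t\<bar> \<le> 1"
    and l: "l = (\<lambda>t i. if i = 0 then (1 + v t) / 2 else (1 - v t) / 2)"
    and A: "S_learning T 2 S A"
  shows "(\<Sum>t<T. (A t l 0 - A t l 1) * v t) / 2 + \<bar>\<Sum>t<T. v t\<bar> / 2 \<le> Reg T 2 A"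
proof -
  have "0 \<le> l t i \<and> l t i \<le> 1" if "t < T" for t i
    using v[OF that] by (auto simp: l)
  then have lL: "l \<in> loss_seqs T 2" by (simp add: loss_seqs_def)
  have A1: "A t l 0 + A t l 1 = 1" if "t < T" for t
  proof -
    have "A t l \<in> simplex 2" using A lL that unfolding S_learning_def by blast
    then show ?thesis by (simp add: two_actions_simplex_iff)
  qed
  have comp: "(INF x\<in>simplex 2. \<Sum>t<T. \<Sum>i<2. x i * l t i) \<le> T / 2 + (x 0 - x 1) * (\<Sum>t<T. v t) / 2"
    if x: "x \<in> simplex 2" for x
  proof -
    have "(INF x\<in>simplex 2. \<Sum>t<T. \<Sum>i<2. x i * l t i) \<le> (\<Sum>t<T. \<Sum>i<2. x i * l t i)"
      using x by (intro cINF_lower bdd_below_comparator_loss lL)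
    also have "\<dots> = (\<Sum>t<T. 1 / 2 + (x 0 - x 1) * v t / 2)"
    proof (rule sum.cong[OF refl])
      fix t
      have "x 1 = 1 - x 0" using x by (simp add: two_actions_simplex_iff)
      then show "(\<Sum>i<2. x i * l t i) = 1 / 2 + (x 0 - x 1) * v t / 2"
        by (simp add: sum_lessThan_two l field_simps)
    qed
    also have "\<dots> = T / 2 + (x 0 - x 1) * (\<Sum>t<T. v t) / 2"
      by (simp add: sum.distrib sum_divide_distrib[symmetric] sum_distrib_left)
    finally show ?thesis .
  qed
  have "(INF x\<in>simplex 2. \<Sum>t<T. \<Sum>i<2. x i * l t i) \<le> T / 2 - \<bar>\<Sum>t<T. v t\<bar> / 2"
    using comp[of "\<lambda>i. if i = 0 then 1 else 0"] comp[of "\<lambda>i. if i = 0 then 0 else 1"]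
    by (simp add: two_actions_simplex_iff abs_if)
  moreover have "(\<Sum>t<T. \<Sum>i<2. A t l i * l t i) = (\<Sum>t<T. 1 / 2 + (A t l 0 - A t l 1) * v t / 2)"
  proof (rule sum.cong[OF refl])
    fix t assume "t \<in> {..<T}"
    then have "A t l 1 = 1 - A t l 0" using A1[of t] by simp
    then show "(\<Sum>i<2. A t l i * l t i) = 1 / 2 + (A t l 0 - A t l 1) * v t / 2"
      by (simp add: sum_lessThan_two l field_simps)
  qed
  then have "(\<Sum>t<T. \<Sum>i<2. A t l i * l t i) = T / 2 + (\<Sum>t<T. (A t l 0 - A t l 1) * v t) / 2"
    by (simp add: sum.distrib sum_divide_distrib[symmetric])
  ultimately have "(\<Sum>t<T. (A t l 0 - A t l 1) * v t) / 2 + \<bar>\<Sum>t<T. v t\<bar> / 2 \<le> regret_seq T 2 A l"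
    by (simp add: regret_seq_def)
  also have "\<dots> \<le> Reg T 2 A" using lL A by (intro regret_seq_le_Reg) auto
  finally show ?thesis .
qed

section \<open>Averaging the regret over random signs\<close>

lemma Reg_ge_of_block_weights:
  fixes P :: "'j set" and a :: "'j \<Rightarrow> real" and J :: "nat \<Rightarrow> 'j set" and mu :: "nat \<Rightarrow> real"
  assumes A: "S_learning T 2 S A"
    and P: "finite P" and J: "\<And>t. t < T \<Longrightarrow> J t \<subseteq> P"
    and a: "\<And>j. j \<in> P \<Longrightarrow> 0 \<le> a j" and a1: "(\<Sum>j\<in>P. a j) \<le> 1"
    and mu: "\<And>t. t < T \<Longrightarrow> 0 \<le> mu t" and aJ: "\<And>t. t < T \<Longrightarrow> (\<Sum>j\<in>J t. a j) = (mu t)\<^sup>2"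
    and disj: "\<And>s t. t < T \<Longrightarrow> s \<in> S t \<Longrightarrow> J s \<inter> J t = {}"
  shows "(\<Sum>t<T. mu t) / 8 \<le> Reg T 2 A"
proof -
  \<comment> \<open>Scaled to squared norm 1. If \<open>mu t = 0\<close>, division by zero yields
    \<open>x t = 0\<close>, hence \<open>v t = 0\<close>.\<close>
  define x where "x = (\<lambda>t j. if j \<in> J t then sqrt (a j) / mu t else 0)"
  define y where "y = (\<lambda>j. sqrt (a j))"
  define v where "v = (\<lambda>t E. Im (riesz P (x t) E) / 2)"
  define l where "l = (\<lambda>E t (i::nat). if i = 0 then (1 + v t E) / 2 else (1 - v t E) / 2)"
  define G where "G = (\<lambda>t E. A t (l E) 0 - A t (l E) 1)"
  have v1: "\<bar>v t E\<bar> \<le> 1" if t: "t < T" for t E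
  proof -
    have "(\<Sum>j\<in>P. (x t j)\<^sup>2) = (\<Sum>j\<in>J t. (sqrt (a j) / mu t)\<^sup>2)"
      unfolding x_def using P J[OF t] by (intro sum.mono_neutral_cong_right) auto
    also have "\<dots> = (\<Sum>j\<in>J t. a j / (mu t)\<^sup>2)"
      using a J[OF t] by (intro sum.cong refl) (auto simp: power_divide)
    also have "\<dots> \<le> 1" by (simp add: sum_divide_distrib[symmetric] aJ[OF t])
    finally show ?thesis using abs_Im_riesz_le[OF P, of "x t" E] by (simp add: v_def)
  qed
  have y1: "\<bar>Im (riesz P y E) / 2\<bar> \<le> 1" for E
  proof -
    have "(\<Sum>j\<in>P. (y j)\<^sup>2) = (\<Sum>j\<in>P. a j)" using a by (intro sum.cong) (auto simp: y_def)
    then show ?thesis using abs_Im_riesz_le[OF P, of y E] a1 by simp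
  qed
  \<comment> \<open>The inner product of \<open>x t\<close> and \<open>y\<close> is
    \<open>(mu t)\<^sup>2 / mu t\<close>; the 1/4 comes from the two halved imaginary parts.\<close>
  have corr: "2 ^ card P * mu t / 4 \<le> (\<Sum>E\<in>Pow P. v t E * (Im (riesz P y E) / 2))"
    if t: "t < T" for t
  proof -
    have "(\<Sum>j\<in>P. x t j * y j) = (\<Sum>j\<in>J t. a j / mu t)"
      unfolding x_def y_def using P J[OF t] a
      by (intro sum.mono_neutral_cong_right) auto
    also have "\<dots> = mu t"
      by (simp add: sum_divide_distrib[symmetric] aJ[OF t] power2_eq_square)
    finally have "2 ^ card P * mu t \<le> (\<Sum>E\<in>Pow P. Im (riesz P (x t) E) * Im (riesz P y E))"
      using sum_Im_riesz_mult_ge[OF P, of "x t" y] mu[OF t] a by (auto simp: x_def y_def)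
    then show ?thesis by (simp add: v_def sum_divide_distrib[symmetric])
  qed
  \<comment> \<open>Flipping \<open>J t\<close> negates \<open>v t\<close> but leaves the losses of
    all observed rounds unchanged, since their blocks avoid \<open>J t\<close>; the action in round
    \<open>t\<close> stays the same.\<close>
  have alg: "(\<Sum>E\<in>Pow P. G t E * v t E) = 0" if t: "t < T" for t
  proof (rule sum_Pow_flip_odd_eq_0[OF P J[OF t]])
    fix E
    show "v t (sym_diff E (J t)) = - v t E"
      unfolding v_def by (subst Im_riesz_flip) (auto simp: x_def split: if_splits)
    have "v s (sym_diff E (J t)) = v s E" if "s \<in> S t" for s
      unfolding v_def using disj[OF t that]
      by (subst riesz_cong[of P "x s" _ E]) (auto simp: x_def split: if_splits)
    moreover have "l E' \<in> loss_seqs T 2" for E'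
      using v1[of _ E'] by (fastforce simp: loss_seqs_def l_def abs_le_iff)
    moreover from calculation have "\<forall>s\<in>S t. \<forall>i<2. l (sym_diff E (J t)) s i = l E s i"
      by (simp add: l_def)
    ultimately have "\<forall>i<2. A t (l (sym_diff E (J t))) i = A t (l E) i"
      using A t unfolding S_learning_def by blast
    then show "G t (sym_diff E (J t)) = G t E" by (simp add: G_def)
  qed
  \<comment> \<open>The 1/8 is the correlation 1/4 times the factor 1/2 in front of
    \<open>\<bar>\<Sum>t<T. v t\<bar>\<close>.\<close>
  have "2 ^ card P * ((\<Sum>t<T. mu t) / 8) = (\<Sum>t<T. 2 ^ card P * mu t / 4) / 2"
    by (simp add: sum_distrib_left sum_divide_distrib)
  also have "\<dots> \<le> (\<Sum>t<T. \<Sum>E\<in>Pow P. v t E * (Im (riesz P y E) / 2)) / 2"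
    using corr by (intro divide_right_mono sum_mono) auto
  also have "\<dots> = (\<Sum>t<T. \<Sum>E\<in>Pow P. G t E * v t E) / 2
      + (\<Sum>t<T. \<Sum>E\<in>Pow P. v t E * (Im (riesz P y E) / 2)) / 2"
    using alg by simp
  also have "\<dots> = (\<Sum>E\<in>Pow P. (\<Sum>t<T. G t E * v t E) / 2 + (\<Sum>t<T. v t E) * (Im (riesz P y E) / 2) / 2)"
    by (subst (1 2) sum.swap) (simp add: sum.distrib sum_divide_distrib sum_distrib_right)
  also have "\<dots> \<le> (\<Sum>E\<in>Pow P. Reg T 2 A)"
  proof (rule sum_mono)
    fix E
    have "(\<Sum>t<T. v t E) * (Im (riesz P y E) / 2) \<le> \<bar>\<Sum>t<T. v t E\<bar> * \<bar>Im (riesz P y E) / 2\<bar>"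
      by (metis abs_ge_self abs_mult)
    also have "\<dots> \<le> \<bar>\<Sum>t<T. v t E\<bar>" using y1 by (intro mult_left_le) auto
    finally show "(\<Sum>t<T. G t E * v t E) / 2 + (\<Sum>t<T. v t E) * (Im (riesz P y E) / 2) / 2 \<le> Reg T 2 A"
      using two_action_regret_ge[of T "\<lambda>t. v t E" "l E" S A] v1 A by (simp add: l_def G_def)
  qed
  also have "\<dots> = 2 ^ card P * Reg T 2 A" using P by (simp add: card_Pow)
  finally show ?thesis by simp
qed

section \<open>Cutting an interval into atoms\<close>

text \<open>Let \<open>a p\<close> be the distance from \<open>p\<close> to its predecessor in
  \<open>P\<close>, so that the sums telescope. A point \<open>p\<close> stands for the atom ending
  at \<open>p\<close>, hence the half-open ranges.\<close>

lemma breakpoint_gaps_exist: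
  fixes P :: "real set"
  assumes "finite P"
  shows "\<exists>a. (\<forall>p\<in>P. 0 \<le> a p) \<and>
    (\<forall>u\<in>P. \<forall>w\<in>P. u \<le> w \<longrightarrow> (\<Sum>p | p \<in> P \<and> u < p \<and> p \<le> w. a p) = w - u)"
  using assms
proof (induction P rule: finite_linorder_max_induct)
  case (insert b P)
  then obtain a where a: "\<And>p. p \<in> P \<Longrightarrow> 0 \<le> a p"
    and sums: "\<And>u w. u \<in> P \<Longrightarrow> w \<in> P \<Longrightarrow> u \<le> w \<Longrightarrow> (\<Sum>p | p \<in> P \<and> u < p \<and> p \<le> w. a p) = w - u"
    by blast
  show ?case
  proof (cases "P = {}")
    case True
    then have "{p. p \<in> insert b P \<and> b < p \<and> p \<le> b} = {}" by auto
    with True show ?thesis by (intro exI[of _ "\<lambda>_. 0"]) auto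
  next
    case False
    define m where "m = Max P"
    have m: "m \<in> P" "\<And>p. p \<in> P \<Longrightarrow> p \<le> m" using False insert.hyps by (auto simp: m_def)
    define a' where "a' = a(b := b - m)"
    have bP: "b \<notin> P" using insert.hyps by auto
    have eq: "(\<Sum>p | p \<in> P \<and> u < p \<and> p \<le> w. a' p) = (\<Sum>p | p \<in> P \<and> u < p \<and> p \<le> w. a p)" for u w
      using bP by (intro sum.cong) (auto simp: a'_def)
    have "(\<Sum>p | p \<in> insert b P \<and> u < p \<and> p \<le> w. a' p) = w - u"
      if u: "u \<in> insert b P" and w: "w \<in> insert b P" and uw: "u \<le> w" for u w
    proof (cases "w = b")
      case w: True
      show ?thesis
      proof (cases "u = b")
        case True
        then show ?thesis using w by (subst sum.neutral) auto
      next
        case False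
        then have uP: "u \<in> P" using u by simp
        then have "u < b" using insert.hyps by auto
        have "{p. p \<in> insert b P \<and> u < p \<and> p \<le> w} = insert b {p. p \<in> P \<and> u < p \<and> p \<le> m}"
          using w m insert.hyps \<open>u < b\<close> by (auto intro: less_imp_le)
        moreover have "(\<Sum>p\<in>insert b {p. p \<in> P \<and> u < p \<and> p \<le> m}. a' p)
            = (b - m) + (\<Sum>p | p \<in> P \<and> u < p \<and> p \<le> m. a' p)"
          using insert.hyps bP by (subst sum.insert) (auto simp: a'_def)
        ultimately show ?thesis using sums[OF uP m(1) m(2)[OF uP]] w by (simp add: eq)
      qed
    next
      case False
      then have wP: "w \<in> P" using w by simp
      then have "w < b" using insert.hyps by auto
      then have uP: "u \<in> P" using u uw by auto
      have "{p. p \<in> insert b P \<and> u < p \<and> p \<le> w} = {p. p \<in> P \<and> u < p \<and> p \<le> w}"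
        using \<open>w < b\<close> by auto
      then show ?thesis using sums[OF uP wP uw] by (simp add: eq)
    qed
    moreover have "\<forall>p\<in>insert b P. 0 \<le> a' p"
      using a m insert.hyps by (auto simp: a'_def intro: less_imp_le)
    ultimately show ?thesis by blast
  qed
qed simp

section \<open>Orders and their maximal extensions\<close>

lemma distinct_if_is_order:
  assumes "temporal_feedback_graph T S" "is_order T S ts"
  shows "distinct ts"
  unfolding distinct_conv_nth
proof (intro allI impI)
  have less: "ts ! u \<noteq> ts ! v" if "u < v" "v < length ts" for u v
  proof -
    have "ts ! v \<in> set ts" using that by simp
    then have "ts ! v < T" using assms(2) unfolding is_order_def by blast
    then have "ts ! v \<notin> S (ts ! v)" using assms(1) by (auto simp: temporal_feedback_graph_def)
    then show ?thesis using assms(2) that by (metis is_order_def)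
  qed
  fix i j assume "i < length ts" "j < length ts" "i \<noteq> j"
  then show "ts ! i \<noteq> ts ! j" using less[of i j] less[of j i] by (cases "i < j") auto
qed

lemma finite_orders:
  assumes "temporal_feedback_graph T S"
  shows "finite {ts. is_order T S ts}"
proof (rule finite_subset)
  show "{ts. is_order T S ts} \<subseteq> {ts. set ts \<subseteq> {..<T} \<and> length ts \<le> T}"
  proof safe
    fix ts assume ts: "is_order T S ts"
    then show sub: "x < T" if "x \<in> set ts" for x using that by (auto simp: is_order_def)
    have "length ts = card (set ts)" using distinct_if_is_order[OF assms ts] by (simp add: distinct_card)
    also have "\<dots> \<le> card {..<T}" using sub by (intro card_mono) auto
    finally show "length ts \<le> T" by simp
  qed
  show "finite {ts. set ts \<subseteq> {..<T} \<and> length ts \<le> T}" by (intro finite_lists_length_le) simp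
qed

text \<open>A longest order above \<open>ts\<close> is maximal, because a super-sequence of equal
  length is equal.\<close>

lemma order_extends_to_maximal:
  assumes fg: "temporal_feedback_graph T S" and ts: "is_order T S ts"
  shows "\<exists>ys\<in>maximal_orders T S. subseq ts ys"
proof -
  define X where "X = {ys. is_order T S ys \<and> subseq ts ys}"
  have "finite X" using finite_orders[OF fg] by (auto simp: X_def)
  moreover have "X \<noteq> {}" using ts by (auto simp: X_def)
  ultimately obtain ys where ys: "ys \<in> X" "\<And>zs. zs \<in> X \<Longrightarrow> length zs \<le> length ys"
    using Max_in[of "length ` X"] Max_ge[of "length ` X"] by (metis (no_types, lifting)
        finite_imageI image_iff image_is_empty image_eqI)
  have "zs = ys" if "is_order T S zs" "subseq ys zs" for zs
  proof -
    have "zs \<in> X" using that ys(1) by (auto simp: X_def intro: subseq_order.order_trans)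
    then have "length ys = length zs" using ys(2) that(2)
      by (meson le_antisym list_emb_length)
    then show ?thesis using that(2) subseq_same_length by metis
  qed
  then show ?thesis using ys(1) by (auto simp: X_def maximal_orders_def)
qed

text \<open>Transitivity enters here: \<open>t\<close> observes \<open>last ts\<close>, which
  observes all earlier entries.\<close>

lemma is_order_append_single:
  assumes tr: "transitive_fg T S" and ts: "is_order T S ts" "ts \<noteq> []" and t: "t < T" "last ts \<in> S t"
  shows "is_order T S (ts @ [t])"
proof -
  have "ts ! u \<in> S t" if u: "u < length ts" for u
  proof (cases "u = length ts - 1")
    case True
    then show ?thesis using t ts(2) by (simp add: last_conv_nth)
  next
    case False
    then have "u < length ts - 1" "length ts - 1 < length ts" using u by auto
    then have "ts ! u \<in> S (ts ! (length ts - 1))" using ts(1) unfolding is_order_def by blast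
    then have "ts ! u \<in> S (last ts)" using ts(2) by (simp add: last_conv_nth)
    then show ?thesis using tr t by (auto simp: transitive_fg_def)
  qed
  then show ?thesis using ts(1) t(1) by (auto simp: is_order_def nth_append less_Suc_eq)
qed

section \<open>From dual weights to the regret bound\<close>

text \<open>Longest-path scheduling: the interval of a round ends at the largest weight of an order
  ending in that round.\<close>

lemma Reg_ge_of_dual_feasible:
  assumes fg: "temporal_feedback_graph T S" and tr: "transitive_fg T S" and A: "S_learning T 2 S A"
    and mu: "\<And>t. t < T \<Longrightarrow> 0 \<le> mu t"
    and chain: "\<And>c. c \<in> maximal_orders T S \<Longrightarrow> (\<Sum>t\<in>set c. (mu t)\<^sup>2) \<le> 1"
  shows "(\<Sum>t<T. mu t) / 8 \<le> Reg T 2 A"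
proof -
  define Ends where "Ends = (\<lambda>t. {c. is_order T S c \<and> c \<noteq> [] \<and> last c = t})"
  define W where "W = (\<lambda>c. \<Sum>t\<in>set c. (mu t)\<^sup>2)"
  \<comment> \<open>Round \<open>t\<close> receives the interval \<open>(h t - (mu t)\<^sup>2, h t]\<close>.\<close>
  define h where "h = (\<lambda>t. Max (W ` Ends t))"
  have finEnds: "finite (Ends t)" for t using finite_orders[OF fg] by (auto simp: Ends_def)
  have single: "[t] \<in> Ends t" if "t < T" for t using that by (auto simp: Ends_def is_order_def)
  have hge: "W c \<le> h t" if "c \<in> Ends t" for c t
    unfolding h_def using finEnds that by (intro Max_ge) auto
  have hex: "\<exists>c\<in>Ends t. h t = W c" if "t < T" for t
  proof -
    have "h t \<in> W ` Ends t"
      unfolding h_def using finEnds single[OF that] by (intro Max_in) auto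
    then show ?thesis by blast
  qed
  have h_low: "(mu t)\<^sup>2 \<le> h t" if "t < T" for t
    using hge[OF single[OF that]] by (simp add: W_def)
  have h_up: "h t \<le> 1" if t: "t < T" for t
  proof -
    obtain c where c: "c \<in> Ends t" "h t = W c" using hex[OF t] by blast
    then obtain ys where ys: "ys \<in> maximal_orders T S" "subseq c ys"
      using order_extends_to_maximal[OF fg] by (auto simp: Ends_def)
    have "set c \<subseteq> set ys" by (auto elim: list_emb_set[OF ys(2)])
    then have "W c \<le> W ys" unfolding W_def by (intro sum_mono2) auto
    then show ?thesis using chain[OF ys(1)] c by (simp add: W_def)
  qed
  \<comment> \<open>Appending \<open>t\<close> to the heaviest order ending in \<open>s\<close>
    gives a competitor for \<open>h t\<close>; as \<open>t\<close> is new there, the weight grows by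
    all of \<open>(mu t)\<^sup>2\<close>.\<close>
  have h_step: "h s \<le> h t - (mu t)\<^sup>2" if t: "t < T" and s: "s \<in> S t" for s t
  proof -
    have "s < T" using fg t s by (auto simp: temporal_feedback_graph_def)
    then obtain c where c: "c \<in> Ends s" "h s = W c" using hex by blast
    then have ord: "is_order T S (c @ [t])"
      using is_order_append_single[OF tr] t s by (auto simp: Ends_def)
    then have "t \<notin> set c" using distinct_if_is_order[OF fg ord] by simp
    then have "W (c @ [t]) = h s + (mu t)\<^sup>2" using c by (simp add: W_def)
    moreover have "W (c @ [t]) \<le> h t" using ord by (intro hge) (simp add: Ends_def)
    ultimately show ?thesis by simp
  qed
  \<comment> \<open>With 0 and 1 among the breakpoints, the atoms in \<open>(0, 1]\<close> have
    total weight 1.\<close>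
  define P where "P = {0, 1} \<union> h ` {..<T} \<union> (\<lambda>t. h t - (mu t)\<^sup>2) ` {..<T}"
  have P: "finite P" "0 \<in> P" "1 \<in> P" by (auto simp: P_def)
  have hP: "h t \<in> P" "h t - (mu t)\<^sup>2 \<in> P" if "t < T" for t using that by (auto simp: P_def)
  obtain a where a: "\<And>p. p \<in> P \<Longrightarrow> 0 \<le> a p"
    and sums: "\<And>u w. u \<in> P \<Longrightarrow> w \<in> P \<Longrightarrow> u \<le> w \<Longrightarrow> (\<Sum>p | p \<in> P \<and> u < p \<and> p \<le> w. a p) = w - u"
    using breakpoint_gaps_exist[OF P(1)] by blast
  define P' where "P' = {p. p \<in> P \<and> 0 < p \<and> p \<le> 1}"
  define J where "J = (\<lambda>t. {p. p \<in> P \<and> h t - (mu t)\<^sup>2 < p \<and> p \<le> h t})"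
  show ?thesis
  proof (rule Reg_ge_of_block_weights[OF A, of P' J a])
    show "finite P'" using P by (simp add: P'_def)
    show "J t \<subseteq> P'" if "t < T" for t
      using h_low[OF that] h_up[OF that] by (auto simp: J_def P'_def)
    show "0 \<le> a j" if "j \<in> P'" for j using a that by (simp add: P'_def)
    show "sum a P' \<le> 1" using sums[OF P(2,3)] by (simp add: P'_def)
    show "sum a (J t) = (mu t)\<^sup>2" if "t < T" for t
      using sums[OF hP(2)[OF that] hP(1)[OF that]] by (simp add: J_def)
    show "J s \<inter> J t = {}" if "t < T" "s \<in> S t" for s t
      using h_step[OF that] by (auto simp: J_def)
  qed (fact mu)
qed

theorem theorem13:
  fixes T :: nat and S :: "nat \<Rightarrow> nat set"
    and A :: "nat \<Rightarrow> (nat \<Rightarrow> nat \<Rightarrow> real) \<Rightarrow> (nat \<Rightarrow> real)"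
  assumes "temporal_feedback_graph T S"
    and "transitive_fg T S"
    and "S_learning T 2 S A"
  shows "Reg T 2 A \<ge> UB T S / 50"
proof -
  let ?N = "maximal_orders T S"
  have N: "finite ?N"
    using finite_orders[OF assms(1)] by (rule rev_finite_subset) (auto simp: maximal_orders_def)
  have cover: "\<exists>c\<in>?N. t \<in> set c" if "t \<in> {..<T}" for t
  proof -
    have "is_order T S [t]" using that by (simp add: is_order_def)
    then show ?thesis
      using order_extends_to_maximal[OF assms(1)] by (fastforce simp: subseq_singleton_left)
  qed
  have sub: "set c \<subseteq> {..<T}" if "c \<in> ?N" for c
    using that by (auto simp: maximal_orders_def is_order_def)
  \<comment> \<open>The sign of \<open>Reg\<close> is recorded because passing from the factor 1/8
    to 1/50 at the end requires it.\<close>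
  have approx: "UB T S \<le> 8 * Reg T 2 A + card ?N * e \<and> 0 \<le> Reg T 2 A" if e: "0 < e" for e :: real
  proof -
    obtain lam mu where lam: "\<forall>t\<in>{..<T}. (\<Sum>c\<in>?N. lam c t) = 1"
        "\<forall>c\<in>?N. \<forall>t. t \<notin> set c \<longrightarrow> lam c t = 0" "\<forall>c\<in>?N. \<forall>t. 0 \<le> lam c t"
      and mu: "\<And>t. t \<in> {..<T} \<Longrightarrow> 0 \<le> mu t" "\<And>c. c \<in> ?N \<Longrightarrow> (\<Sum>t\<in>set c. (mu t)\<^sup>2) \<le> 1"
      and le: "(\<Sum>c\<in>?N. sqrt (\<Sum>t\<in>set c. (lam c t)\<^sup>2)) \<le> (\<Sum>t<T. mu t) + card ?N * e"
      using fractional_cover_approx_duality[of ?N "{..<T}" set e, OF N finite_lessThan sub cover e]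
      by blast
    have "UB T S \<le> (\<Sum>c\<in>?N. sqrt (\<Sum>t\<in>set c. (lam c t)\<^sup>2))"
      unfolding UB_def
    proof (rule cInf_lower)
      show "bdd_below {(\<Sum>c\<in>?N. sqrt (\<Sum>t\<in>set c. (lam c t)\<^sup>2)) | lam.
          (\<forall>t<T. (\<Sum>c\<in>?N. lam c t) = 1) \<and> (\<forall>c\<in>?N. \<forall>t. t \<notin> set c \<longrightarrow> lam c t = 0) \<and>
          (\<forall>c\<in>?N. \<forall>t. 0 \<le> lam c t)}"
        by (rule bdd_belowI[of _ 0]) (auto intro!: sum_nonneg)
    qed (use lam in auto)
    moreover have "(\<Sum>t<T. mu t) / 8 \<le> Reg T 2 A"
      using mu by (intro Reg_ge_of_dual_feasible[OF assms]) auto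
    moreover have "0 \<le> (\<Sum>t<T. mu t)" using mu(1) by (intro sum_nonneg) auto
    ultimately show ?thesis using le by auto
  qed
  have "UB T S \<le> 8 * Reg T 2 A"
  proof (rule field_le_epsilon)
    fix e :: real assume e: "0 < e"
    \<comment> \<open>The \<open>+ 1\<close> keeps the denominator positive while the total error
      stays below \<open>e\<close>.\<close>
    have "card ?N * (e / (card ?N + 1)) \<le> e" using e by (simp add: field_simps)
    then show "UB T S \<le> 8 * Reg T 2 A + e"
      using approx[of "e / (card ?N + 1)"] e by (simp add: add_pos_nonneg)
  qed
  then show ?thesis using approx[of 1] by simp
qed

end
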